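(* Let $K$ be a field and let $A=K^2$ with multiplication $(\lambda_1,\lambda_2)\star(\mu_1,\mu_2):=(0,\lambda_1\mu_1)$ and twisting map $\alpha:K^2\to K^2$, $\alpha(\lambda,\mu):=(\lambda+\mu,\mu)$; then $(A,\star,\alpha)$ is a hom-associative $K$-algebra. There is no embedding of $(A,\star,\alpha)$ into a weakly unital hom-associative $K$-algebra; that is, there are no weakly unital hom-associative $K$-algebra $(B,\star_B,\beta)$ and injective $K$-linear map $\iota:A\to B$ such that $\iota(x\star y)=\iota(x)\star_B\iota(y)$ and $\iota(\alpha(x))=\beta(\iota(x))$ for all $x,y\in A$.
   Context: A hom-associative $K$-algebra $(B,\star,\beta)$ is a $K$-vector space $B$ with a $K$-bilinear, not necessarily associative, product $\star$ and a $K$-linear map $\beta:B\to B$ (the twisting map, not assumed multiplicative) such that $\beta(x)\star(y\star z)=(x\star y)\star\beta(z)$ for all $x,y,z\in B$. It is left weakly unital if there is $c\in B$ with $\beta(x)=c\star x$ for all $x\in B$, right weakly unital if there is $c\in B$ with $\beta(x)=x\star c$ for all $x\in B$, and weakly unital if it is both left and right weakly unital. *)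

theory Defs
  imports Complex_Main "HOL-Library.Product_Plus"
begin

locale hom_assoc_algebra = vector_space scale
  for scale :: "'k::field \<Rightarrow> 'b::ab_group_add \<Rightarrow> 'b" +
  fixes mult :: "'b \<Rightarrow> 'b \<Rightarrow> 'b" and twist :: "'b \<Rightarrow> 'b"
  assumes linear_mult_left: "Vector_Spaces.linear scale scale (\<lambda>x. mult x y)"
    and linear_mult_right: "Vector_Spaces.linear scale scale (mult x)"
    and linear_twist: "Vector_Spaces.linear scale scale twist"
    and hom_assoc: "mult (twist x) (mult y z) = mult (mult x y) (twist z)"

definition left_weakly_unital :: "('b \<Rightarrow> 'b \<Rightarrow> 'b) \<Rightarrow> ('b \<Rightarrow> 'b) \<Rightarrow> bool" where
  "left_weakly_unital mult twist \<longleftrightarrow> (\<exists>c. \<forall>x. twist x = mult c x)"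

definition right_weakly_unital :: "('b \<Rightarrow> 'b \<Rightarrow> 'b) \<Rightarrow> ('b \<Rightarrow> 'b) \<Rightarrow> bool" where
  "right_weakly_unital mult twist \<longleftrightarrow> (\<exists>c. \<forall>x. twist x = mult x c)"

text \<open>The elements witnessing left and right weak unitality need not coincide.\<close>

definition weakly_unital :: "('b \<Rightarrow> 'b \<Rightarrow> 'b) \<Rightarrow> ('b \<Rightarrow> 'b) \<Rightarrow> bool" where
  "weakly_unital mult twist \<longleftrightarrow> left_weakly_unital mult twist \<and> right_weakly_unital mult twist"

definition hom_embedding ::
  "('k::field \<Rightarrow> 'a::ab_group_add \<Rightarrow> 'a) \<Rightarrow> ('a \<Rightarrow> 'a \<Rightarrow> 'a) \<Rightarrow> ('a \<Rightarrow> 'a) \<Rightarrow>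
   ('k \<Rightarrow> 'b::ab_group_add \<Rightarrow> 'b) \<Rightarrow> ('b \<Rightarrow> 'b \<Rightarrow> 'b) \<Rightarrow> ('b \<Rightarrow> 'b) \<Rightarrow> ('a \<Rightarrow> 'b) \<Rightarrow> bool" where
  "hom_embedding scaleA multA twistA scaleB multB twistB \<iota> \<longleftrightarrow>
     Vector_Spaces.linear scaleA scaleB \<iota> \<and> inj \<iota> \<and>
     (\<forall>x y. \<iota> (multA x y) = multB (\<iota> x) (\<iota> y)) \<and>
     (\<forall>x. \<iota> (twistA x) = twistB (\<iota> x))"

definition K2_scale :: "'k::field \<Rightarrow> 'k \<times> 'k \<Rightarrow> 'k \<times> 'k" where
  "K2_scale a v = (a * fst v, a * snd v)"

definition K2_mult :: "'k::field \<times> 'k \<Rightarrow> 'k \<times> 'k \<Rightarrow> 'k \<times> 'k" where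
  "K2_mult v w = (0, fst v * fst w)"

definition K2_twist :: "'k::field \<times> 'k \<Rightarrow> 'k \<times> 'k" where
  "K2_twist v = (fst v + snd v, snd v)"

end

theory Submission
  imports Defs
begin

text \<open>Hom-associativity applied to a triple that starts with a left weak unit \<open>c\<close> reads
  \<open>\<beta>(c) (x y) = (c x) \<beta>(y) = \<beta>(x) \<beta>(y)\<close>. Left weak unitality therefore forces the
  twisting map to preserve the relation \<open>x y = 0\<close>, and any algebra embedded compatibly
  with products and twisting maps inherits this. In \<open>K\<^sup>2\<close> the relation is not
  preserved: \<open>e\<^sub>1 e\<^sub>2 = 0\<close>, whereas
  \<open>\<alpha>(e\<^sub>1) \<alpha>(e\<^sub>2) = e\<^sub>1 (e\<^sub>1 + e\<^sub>2) = e\<^sub>2\<close>.\<close>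

lemma twist_preserves_zero_products:
  assumes "hom_assoc_algebra scale mult twist" and "left_weakly_unital mult twist"
    and "mult x y = 0"
  shows "mult (twist x) (twist y) = 0"
proof -
  interpret hom_assoc_algebra scale mult twist by fact
  obtain c where c: "\<And>x. twist x = mult c x"
    using assms(2) by (auto simp: left_weakly_unital_def)
  have "mult (twist x) (twist y) = mult (mult c x) (twist y)" by (simp only: c)
  also have "\<dots> = mult (twist c) (mult x y)" by (rule hom_assoc[symmetric])
  also have "\<dots> = 0"
    using module_hom.zero[OF Vector_Spaces.linear.axioms(3)[OF linear_mult_right]] assms(3)
    by simp
  finally show ?thesis .
qed

lemma vector_space_K2: "vector_space K2_scale"
  by unfold_locales (auto simp: K2_scale_def algebra_simps)

lemma hom_assoc_algebra_K2: "hom_assoc_algebra K2_scale K2_mult K2_twist"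
proof -
  interpret vector_space K2_scale by (rule vector_space_K2)
  show ?thesis
    by unfold_locales (auto simp: K2_scale_def K2_mult_def K2_twist_def algebra_simps)
qed

theorem mainTheorem4:
  shows "hom_assoc_algebra (K2_scale :: 'k::field \<Rightarrow> 'k \<times> 'k \<Rightarrow> 'k \<times> 'k) K2_mult K2_twist \<and>
    \<not> (\<exists>(scaleB :: 'k \<Rightarrow> 'b::ab_group_add \<Rightarrow> 'b) multB \<beta> \<iota>.
          hom_assoc_algebra scaleB multB \<beta> \<and> weakly_unital multB \<beta> \<and>
          hom_embedding K2_scale K2_mult K2_twist scaleB multB \<beta> \<iota>)"
proof (intro conjI notI)
  show "hom_assoc_algebra (K2_scale :: 'k \<Rightarrow> _) K2_mult K2_twist"
    by (rule hom_assoc_algebra_K2)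
next
  assume "\<exists>(scaleB :: 'k \<Rightarrow> 'b \<Rightarrow> 'b) multB \<beta> \<iota>.
          hom_assoc_algebra scaleB multB \<beta> \<and> weakly_unital multB \<beta> \<and>
          hom_embedding K2_scale K2_mult K2_twist scaleB multB \<beta> \<iota>"
  then obtain scaleB :: "'k \<Rightarrow> 'b \<Rightarrow> 'b" and multB \<beta> \<iota>
    where B: "hom_assoc_algebra scaleB multB \<beta>" and unital: "left_weakly_unital multB \<beta>"
      and lin: "Vector_Spaces.linear K2_scale scaleB \<iota>" and "inj \<iota>"
      and mult: "\<And>x y. \<iota> (K2_mult x y) = multB (\<iota> x) (\<iota> y)"
      and twist: "\<And>x. \<iota> (K2_twist x) = \<beta> (\<iota> x)"
    by (auto simp: weakly_unital_def hom_embedding_def)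
  have zero: "\<iota> 0 = 0"
    by (rule module_hom.zero[OF Vector_Spaces.linear.axioms(3)[OF lin]])
  define e1 e2 :: "'k \<times> 'k" where "e1 = (1, 0)" and "e2 = (0, 1)"
  have "K2_mult e1 e2 = 0"
    by (simp add: K2_mult_def e1_def e2_def zero_prod_def)
  then have "multB (\<iota> e1) (\<iota> e2) = 0" using mult[of e1 e2] zero by simp
  then have "multB (\<beta> (\<iota> e1)) (\<beta> (\<iota> e2)) = 0"
    by (rule twist_preserves_zero_products[OF B unital])
  then have "\<iota> (K2_mult (K2_twist e1) (K2_twist e2)) = \<iota> 0"
    by (simp only: mult twist zero)
  then have "K2_mult (K2_twist e1) (K2_twist e2) = 0"
    using \<open>inj \<iota>\<close> by (simp only: inj_eq)
  then show False
    by (simp add: K2_mult_def K2_twist_def e1_def e2_def zero_prod_def)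
qed

end
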